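(* For every positive integer $n$, the complete graph $K_n$ on $n$ vertices satisfies $E_{\mathrm{ISI}}(K_n)=(n-1)^2$.
   Context: For a simple graph $G$ with vertices $v_1,\dots,v_n$, let $d_i$ be the degree of $v_i$. The ISI matrix $S(G)=[s_{ij}]_{n\times n}$ has $s_{ij}=\frac{d_id_j}{d_i+d_j}$ if $v_i$ and $v_j$ are adjacent and $s_{ij}=0$ otherwise. The ISI energy is $E_{\mathrm{ISI}}(G)=\sum_{i=1}^n|\tau_i|$, where $\tau_1,\dots,\tau_n$ are the eigenvalues of $S(G)$ counted with multiplicity. *)

theory Defs
  imports
    "Graph_Theory.Kuratowski"
    "Jordan_Normal_Form.Char_Poly"
    "HOL-Computational_Algebra.Fundamental_Theorem_Algebra"
begin

text \<open>
  A simple graph is a term satisfying \<^locale>\<open>graph\<close>: finite, loop-free, without parallel arcs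
  and symmetric, so that every edge is represented by two opposite arcs. Hence the degree of a
  vertex is its out-degree, and \<open>u\<close> and \<open>v\<close> are adjacent iff \<open>u \<rightarrow>\<^bsub>G\<^esub> v\<close>. 
  The list \<open>vs\<close> is the enumeration of the vertices that indexes the rows and columns.
\<close>

definition ISI_mat :: "('a, 'b) pre_digraph \<Rightarrow> 'a list \<Rightarrow> real mat" where
  "ISI_mat G vs = mat (length vs) (length vs) (\<lambda>(i, j).
     if vs ! i \<rightarrow>\<^bsub>G\<^esub> vs ! j
     then real (out_degree G (vs ! i)) * real (out_degree G (vs ! j)) /
          (real (out_degree G (vs ! i)) + real (out_degree G (vs ! j)))
     else 0)"

definition eigenvalues_mset :: "complex mat \<Rightarrow> complex multiset" where
  "eigenvalues_mset A = proots (char_poly A)"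

lemma set_eigenvalues_mset:
  assumes "A \<in> carrier_mat n n"
  shows "set_mset (eigenvalues_mset A) = {k. eigenvalue A k}"
proof -
  have "char_poly A \<noteq> 0"
    using degree_monic_char_poly[OF assms] by auto
  then show ?thesis
    by (simp add: eigenvalues_mset_def eigenvalue_root_char_poly[OF assms])
qed

lemma size_eigenvalues_mset:
  assumes "A \<in> carrier_mat n n"
  shows "size (eigenvalues_mset A) = n"
  using degree_monic_char_poly[OF assms]
  by (simp add: eigenvalues_mset_def size_proots_complex)

text \<open>
  The eigenvalues are taken over the complex numbers, so that there are always
  \<^term>\<open>length vs\<close> of them; for a graph the matrix is symmetric, and they are all real.
\<close>

definition ISI_energy :: "('a, 'b) pre_digraph \<Rightarrow> 'a list \<Rightarrow> real" where
  "ISI_energy G vs =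
     (\<Sum>\<tau>\<in>#eigenvalues_mset (map_mat complex_of_real (ISI_mat G vs)). cmod \<tau>)"

end

theory Submission
  imports Defs
begin

text \<open>
  All vertices of \<open>K\<^sub>n\<close> have degree \<open>n - 1\<close>, so the ISI matrix is \<open>c (J - I)\<close> with
  \<open>c = (n - 1) / 2\<close> and \<open>J\<close> the all-ones matrix. Its eigenvalues are \<open>c (n - 1)\<close>, once, and
  \<open>-c\<close>, with multiplicity \<open>n - 1\<close>, whence the energy is \<open>2 c (n - 1) = (n - 1)\<^sup>2\<close>.
\<close>

text \<open>
  Passing from the standard basis to the one whose first vector is the all-ones vector makes the
  matrix upper triangular.
\<close>

lemma det_const_diagonal_const_off_diagonal:
  fixes a b :: "'a :: idom"
  assumes "n > 0"
  shows "det (mat n n (\<lambda>(i, j). if i = j then a else b)) =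
    (a + of_nat (n - 1) * b) * (a - b) ^ (n - 1)"
proof -
  define A where "A = mat n n (\<lambda>(i, j). if i = j then a else b)"
  \<comment> \<open>Column 0 of \<open>P\<close> is the all-ones vector \<open>u\<close>, column
    \<open>j > 0\<close> the unit vector \<open>e_j\<close>.\<close>
  define P :: "'a mat" where "P = mat n n (\<lambda>(i, j). if j = 0 \<or> i = j then 1 else 0)"
  \<comment> \<open>The columns of \<open>B\<close> record \<open>A u = (a + (n - 1) b) u\<close>
    and \<open>A e_j = b u + (a - b) e_j\<close>.\<close>
  define B where "B = mat n n (\<lambda>(i, j).
    if i = 0 then (if j = 0 then a + of_nat (n - 1) * b else b) else if i = j then a - b else 0)"
  have carrier: "A \<in> carrier_mat n n" "P \<in> carrier_mat n n" "B \<in> carrier_mat n n"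
    by (auto simp: A_def P_def B_def)
  have split0: "(\<Sum>k\<in>{0..<n}. f k) = f 0 + (\<Sum>k\<in>{1..<n}. f k)" for f :: "nat \<Rightarrow> 'a"
    using assms by (simp add: sum.atLeast_Suc_lessThan)
  have "A * P = P * B"
  proof (rule eq_matI)
    fix i j assume "i < dim_row (P * B)" "j < dim_col (P * B)"
    then have ij: "i < n" "j < n" using carrier by auto
    have AP: "(A * P) $$ (i, j) =
        (\<Sum>k\<in>{0..<n}. (if i = k then a else b) * (if j = 0 \<or> k = j then 1 else 0))"
      using ij by (simp add: A_def P_def scalar_prod_def)
    have "(P * B) $$ (i, j) = (\<Sum>k\<in>{0..<n}. (if k = 0 \<or> i = k then 1 else 0) * B $$ (k, j))"
      using ij carrier by (simp add: P_def scalar_prod_def)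
    \<comment> \<open>Row \<open>i\<close> of \<open>P\<close> has ones in columns \<open>0\<close>
      and \<open>i\<close>, which coincide for \<open>i = 0\<close>; hence the case distinction that
      follows.\<close>
    also have "\<dots> = B $$ (0, j) + (\<Sum>k\<in>{1..<n}. if i = k then B $$ (k, j) else 0)"
      unfolding split0 by (intro arg_cong2[where f = "(+)"] sum.cong) auto
    also have "\<dots> = B $$ (0, j) + (if i = 0 then 0 else B $$ (i, j))"
      using ij by (auto simp: sum.delta')
    finally have PB: "(P * B) $$ (i, j) = B $$ (0, j) + (if i = 0 then 0 else B $$ (i, j))" .
    show "(A * P) $$ (i, j) = (P * B) $$ (i, j)"
    proof (cases "j = 0")
      case True
      have "(\<Sum>k\<in>{0..<n}. if i = k then a else b) =
          a + (\<Sum>k\<in>{0..<n} - {i}. if i = k then a else b)"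
        using ij by (subst sum.remove[of _ i]) auto
      also have "(\<Sum>k\<in>{0..<n} - {i}. if i = k then a else b) = (\<Sum>k\<in>{0..<n} - {i}. b)"
        by (rule sum.cong) auto
      finally show ?thesis
        using True ij unfolding AP PB by (simp add: B_def)
    next
      case False
      have "(A * P) $$ (i, j) = (\<Sum>k\<in>{0..<n}. if k = j then if i = j then a else b else 0)"
        unfolding AP using False by (intro sum.cong) auto
      then show ?thesis
        using False ij unfolding PB by (simp add: B_def)
    qed
  qed (use carrier in auto)
  \<comment> \<open>\<open>A P = P B\<close> stands in for a similarity, so no inverse of
    \<open>P\<close> is formed and an integral domain suffices.\<close>
  then have "det A * det P = det P * det B"
    using carrier by (metis det_mult)
  moreover have "det P = 1"
  proof -
    have "det P = prod_list (diag_mat P)"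
      by (rule det_lower_triangular[of n]) (auto simp: P_def)
    also have "diag_mat P = map (\<lambda>_. 1) [0..<n]"
      by (auto simp: diag_mat_def P_def)
    finally show ?thesis by (simp add: map_replicate_const)
  qed
  moreover have "det B = (a + of_nat (n - 1) * b) * (a - b) ^ (n - 1)"
  proof -
    have "det B = prod_list (diag_mat B)"
      by (rule det_upper_triangular[of _ n]) (auto simp: B_def)
    also have "diag_mat B = map (\<lambda>i. B $$ (i, i)) (0 # [1..<n])"
      using assms carrier by (simp add: diag_mat_def upt_conv_Cons)
    also have "\<dots> = (a + of_nat (n - 1) * b) # map (\<lambda>_. a - b) [1..<n]"
      using assms by (auto simp: B_def)
    finally show ?thesis by (simp add: map_replicate_const)
  qed
  ultimately show ?thesis by (simp add: A_def)
qed

text \<open>The characteristic matrix has \<open>x\<close> on the diagonal and \<open>-c\<close> off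
  it, so the determinant formula applies over the polynomial ring, which is why that formula is
  stated for integral domains rather than fields.\<close>

lemma char_poly_zero_diagonal_const_off_diagonal:
  fixes c :: "'a :: idom"
  assumes "n > 0"
  shows "char_poly (mat n n (\<lambda>(i, j). if i = j then 0 else c)) =
    [:- (of_nat (n - 1) * c), 1:] * [:c, 1:] ^ (n - 1)"
proof -
  have "char_poly_matrix (mat n n (\<lambda>(i, j). if i = j then 0 else c)) =
      mat n n (\<lambda>(i, j). if i = j then [:0, 1:] else [:- c:])"
    by (rule eq_matI) (auto simp: char_poly_matrix_def)
  then show ?thesis
    unfolding char_poly_def
    by (simp add: det_const_diagonal_const_off_diagonal[OF assms] of_nat_poly mult.commute)
qed

text \<open>Without parallel arcs, an arc leaving \<open>u\<close> is determined by its
  head.\<close>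

lemma (in nomulti_digraph) out_degree_eq_card_dominated:
  "out_degree G u = card {v. u \<rightarrow>\<^bsub>G\<^esub> v}"
proof -
  have "inj_on (head G) (out_arcs G u)"
    by (rule inj_onI) (auto simp: arc_to_ends_def intro: no_multi_arcs)
  moreover have "head G ` out_arcs G u = {v. u \<rightarrow>\<^bsub>G\<^esub> v}"
    by (force simp: arcs_ends_def arc_to_ends_def)
  ultimately show ?thesis
    unfolding out_degree_def by (metis card_image)
qed

lemma out_degree_complete_digraph:
  assumes "complete_digraph n G" and "u \<in> verts G"
  shows "out_degree G u = n - 1"
proof -
  interpret graph G using assms(1) by (simp add: complete_digraph_def)
  have "{v. u \<rightarrow>\<^bsub>G\<^esub> v} = verts G - {u}"
    using assms by (auto simp: complete_digraph_def)
  then show ?thesis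
    using assms by (simp add: out_degree_eq_card_dominated complete_digraph_def)
qed

text \<open>With all degrees equal to \<open>d = n - 1\<close>, the weight of an edge is
  \<open>d * d / (d + d) = d / 2\<close>. Distinctness of \<open>vs\<close> turns adjacency into
  inequality of indices.\<close>

lemma ISI_mat_complete_digraph:
  assumes "complete_digraph n G" and "distinct vs" and "set vs = verts G"
  shows "ISI_mat G vs = mat n n (\<lambda>(i, j). if i = j then 0 else real (n - 1) / 2)"
proof -
  have len: "length vs = n"
    using assms by (metis complete_digraph_def distinct_card)
  have mem: "vs ! i \<in> verts G" if "i < n" for i
    using that assms(3) len nth_mem by blast
  have adj: "vs ! i \<rightarrow>\<^bsub>G\<^esub> vs ! j \<longleftrightarrow> i \<noteq> j" if "i < n" "j < n" for i j
    using that assms(1,2) mem len by (auto simp: complete_digraph_def nth_eq_iff_index_eq)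
  show ?thesis
    by (rule eq_matI)
      (auto simp: ISI_mat_def len adj mem out_degree_complete_digraph[OF assms(1)] field_simps)
qed

theorem theorem3p3:
  fixes G :: "('a, 'b) pre_digraph" and vs :: "'a list" and n :: nat
  assumes "n \<ge> 1"
    and "complete_digraph n G"
    and "distinct vs" and "set vs = verts G"
  shows "ISI_energy G vs = (real n - 1)\<^sup>2"
proof -
  define c where "c = complex_of_real (real (n - 1) / 2)"
  have "map_mat complex_of_real (ISI_mat G vs) = mat n n (\<lambda>(i, j). if i = j then 0 else c)"
    unfolding ISI_mat_complete_digraph[OF assms(2-4)] by (rule eq_matI) (auto simp: c_def)
  then have "eigenvalues_mset (map_mat complex_of_real (ISI_mat G vs)) =
      proots ([:- (of_nat (n - 1) * c), 1:] * [:c, 1:] ^ (n - 1))"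
    using assms(1) by (simp add: eigenvalues_mset_def char_poly_zero_diagonal_const_off_diagonal)
  also have "\<dots> = proots [:- (of_nat (n - 1) * c), 1:] + proots ([:c, 1:] ^ (n - 1))"
    by (rule proots_mult) auto
  \<comment> \<open>For \<open>n = 1\<close> the second summand is empty and the only eigenvalue is
    0.\<close>
  also have "\<dots> = {#of_nat (n - 1) * c#} + repeat_mset (n - 1) {#- c#}"
    using proots_linear_factor[of "- (of_nat (n - 1) * c)"] proots_linear_factor[of c]
    by (simp add: proots_power)
  finally have "ISI_energy G vs = cmod (of_nat (n - 1) * c) + real (n - 1) * cmod c"
    by (simp add: ISI_energy_def)
  \<comment> \<open>The trace vanishes, so the one positive eigenvalue and the negative ones
    contribute equally: hence the factor 2, which cancels the denominator of
    \<open>c\<close>.\<close>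
  also have "\<dots> = real (n - 1) * (2 * cmod c)"
    by (simp add: norm_mult del: of_nat_diff)
  also have "2 * cmod c = real (n - 1)"
    by (simp add: c_def norm_divide del: of_nat_diff)
  finally show ?thesis
    using assms(1) by (simp add: power2_eq_square of_nat_diff)
qed

end
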